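(* For any three imaginary Fibonacci quaternions $F_k,F_m,F_n$ (with $k,m,n\in\mathbb{N}$), one has $$\langle F_k\times F_m,\,F_n\rangle=0.$$ Therefore, the vectors $F_k,F_m,F_n$ are linearly dependent (over $\mathbb{R}$).
   Context: Let $\mathbb{H}$ be the real division quaternion algebra with standard basis $1,\mathbf{i},\mathbf{j},\mathbf{k}$, and let $\mathbb{H}_0$ be the subspace of quaternions of trace $0$, i.e. those of the form $x_1\mathbf{i}+x_2\mathbf{j}+x_3\mathbf{k}$ with $x_i\in\mathbb{R}$, identified with $\mathbb{R}^3$. For $n\in\mathbb{N}=\{0,1,2,\dots\}$, the imaginary Fibonacci quaternion $F_n\in\mathbb{H}_0$ is $F_n=f_n\mathbf{i}+f_{n+1}\mathbf{j}+f_{n+2}\mathbf{k}$, where $(f_j)$ is the Fibonacci sequence $f_0=0$, $f_1=1$, $f_j=f_{j-1}+f_{j-2}$ for $j\ge2$. For $x=x_1\mathbf{i}+x_2\mathbf{j}+x_3\mathbf{k}$ and $y=y_1\mathbf{i}+y_2\mathbf{j}+y_3\mathbf{k}$, the inner product is $\langle x,y\rangle=x_1y_1+x_2y_2+x_3y_3$ and $x\times y=xy+\langle x,y\rangle$ is the usual cross product on $\mathbb{R}^3$, i.e. $x\times y=(x_2y_3-x_3y_2)\mathbf{i}+(x_3y_1-x_1y_3)\mathbf{j}+(x_1y_2-x_2y_1)\mathbf{k}$. *)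

theory Defs
  imports Complex_Main "HOL-Number_Theory.Fib"
begin

datatype quaternion = Quaternion (Q0: real) (Q1: real) (Q2: real) (Q3: real)

lemma quaternion_eq_iff:
  "x = y \<longleftrightarrow> Q0 x = Q0 y \<and> Q1 x = Q1 y \<and> Q2 x = Q2 y \<and> Q3 x = Q3 y"
  by (cases x; cases y) auto

instantiation quaternion :: real_div_algebra
begin

definition zero_quaternion where "0 = Quaternion 0 0 0 0"
definition one_quaternion where "1 = Quaternion 1 0 0 0"
definition plus_quaternion where
  "x + y = Quaternion (Q0 x + Q0 y) (Q1 x + Q1 y) (Q2 x + Q2 y) (Q3 x + Q3 y)"
definition uminus_quaternion where
  "- x = Quaternion (- Q0 x) (- Q1 x) (- Q2 x) (- Q3 x)"
definition minus_quaternion where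
  "x - y = Quaternion (Q0 x - Q0 y) (Q1 x - Q1 y) (Q2 x - Q2 y) (Q3 x - Q3 y)"
definition scaleR_quaternion where
  "r *\<^sub>R x = Quaternion (r * Q0 x) (r * Q1 x) (r * Q2 x) (r * Q3 x)"
definition times_quaternion where
  "x * y = Quaternion
    (Q0 x * Q0 y - Q1 x * Q1 y - Q2 x * Q2 y - Q3 x * Q3 y)
    (Q0 x * Q1 y + Q1 x * Q0 y + Q2 x * Q3 y - Q3 x * Q2 y)
    (Q0 x * Q2 y - Q1 x * Q3 y + Q2 x * Q0 y + Q3 x * Q1 y)
    (Q0 x * Q3 y + Q1 x * Q2 y - Q2 x * Q1 y + Q3 x * Q0 y)"
definition inverse_quaternion where
  "inverse x =
    (let N = (Q0 x)\<^sup>2 + (Q1 x)\<^sup>2 + (Q2 x)\<^sup>2 + (Q3 x)\<^sup>2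
     in Quaternion (Q0 x / N) (- Q1 x / N) (- Q2 x / N) (- Q3 x / N))"
definition divide_quaternion where
  "x div y = x * inverse (y :: quaternion)"

lemmas quaternion_defs =
  zero_quaternion_def one_quaternion_def plus_quaternion_def uminus_quaternion_def
  minus_quaternion_def scaleR_quaternion_def times_quaternion_def

lemma quaternion_normsq_nonzero:
  "x \<noteq> 0 \<Longrightarrow> (Q0 x)\<^sup>2 + (Q1 x)\<^sup>2 + (Q2 x)\<^sup>2 + (Q3 x)\<^sup>2 \<noteq> 0"
  by (simp add: quaternion_eq_iff zero_quaternion_def add_nonneg_eq_0_iff)

instance
proof
  fix x :: quaternion
  assume x: "x \<noteq> 0"
  define N where "N = (Q0 x)\<^sup>2 + (Q1 x)\<^sup>2 + (Q2 x)\<^sup>2 + (Q3 x)\<^sup>2"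
  have "N \<noteq> 0" using quaternion_normsq_nonzero[OF x] by (simp add: N_def)
  moreover have "Q0 x * Q0 x + Q1 x * Q1 x + Q2 x * Q2 x + Q3 x * Q3 x = N"
    by (simp add: N_def power2_eq_square)
  ultimately show "inverse x * x = 1" and "x * inverse x = 1"
    by (simp_all add: inverse_quaternion_def quaternion_defs Let_def N_def[symmetric]
          add_divide_distrib[symmetric])
      (simp_all add: field_simps)
qed (simp_all add: quaternion_eq_iff quaternion_defs inverse_quaternion_def
      divide_quaternion_def algebra_simps)

end

definition q_i :: quaternion where "q_i = Quaternion 0 1 0 0"
definition q_j :: quaternion where "q_j = Quaternion 0 0 1 0"
definition q_k :: quaternion where "q_k = Quaternion 0 0 0 1"

lemma quaternion_units:
  "q_i * q_i = -1" "q_j * q_j = -1" "q_k * q_k = -1"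
  "q_i * q_j = q_k" "q_j * q_k = q_i" "q_k * q_i = q_j"
  "q_j * q_i = - q_k" "q_k * q_j = - q_i" "q_i * q_k = - q_j"
  by (simp_all add: q_i_def q_j_def q_k_def quaternion_defs)

definition q_trace :: "quaternion \<Rightarrow> real" where
  "q_trace x = 2 * Q0 x"

definition imag_quaternions :: "quaternion set" where
  "imag_quaternions = {x. q_trace x = 0}"

text \<open>The inner product and the cross product are meant for arguments in
  \<^const>\<open>imag_quaternions\<close>; their values on other quaternions are irrelevant.\<close>

definition q_inner :: "quaternion \<Rightarrow> quaternion \<Rightarrow> real" where
  "q_inner x y = Q1 x * Q1 y + Q2 x * Q2 y + Q3 x * Q3 y"

definition q_cross :: "quaternion \<Rightarrow> quaternion \<Rightarrow> quaternion" where
  "q_cross x y = x * y + of_real (q_inner x y)"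

lemma q_cross_coords:
  assumes "x \<in> imag_quaternions" "y \<in> imag_quaternions"
  shows "q_cross x y =
    (Q2 x * Q3 y - Q3 x * Q2 y) *\<^sub>R q_i
    + (Q3 x * Q1 y - Q1 x * Q3 y) *\<^sub>R q_j
    + (Q1 x * Q2 y - Q2 x * Q1 y) *\<^sub>R q_k"
  using assms
  by (simp add: q_cross_def q_inner_def imag_quaternions_def q_trace_def of_real_def quaternion_defs
      q_i_def q_j_def q_k_def)

definition fib_quaternion :: "nat \<Rightarrow> quaternion" where
  "fib_quaternion n =
    real (fib n) *\<^sub>R q_i + real (fib (n + 1)) *\<^sub>R q_j + real (fib (n + 2)) *\<^sub>R q_k"

lemma fib_quaternion_imag: "fib_quaternion n \<in> imag_quaternions"
  by (simp add: fib_quaternion_def imag_quaternions_def q_trace_def quaternion_defs q_i_def q_j_def q_k_def)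

text \<open>The library predicate \<^const>\<open>real_vector.dependent\<close> concerns sets and would lose
  repetitions: a triple with two equal entries is a dependent family, while the
  set of its entries may be independent.\<close>

definition linearly_dependent3 :: "'a::real_vector \<Rightarrow> 'a \<Rightarrow> 'a \<Rightarrow> bool" where
  "linearly_dependent3 x y z \<longleftrightarrow>
    (\<exists>a b c :: real. \<not> (a = 0 \<and> b = 0 \<and> c = 0) \<and> a *\<^sub>R x + b *\<^sub>R y + c *\<^sub>R z = 0)"

end

theory Submission
  imports Defs
begin

text \<open>The Fibonacci recurrence makes the third coordinate of every \<open>F\<^sub>n\<close> the sum of the first
  two, so all the vectors \<open>F\<^sub>n\<close> lie in the plane spanned by \<open>\<^bold>i + \<^bold>k\<close> and \<open>\<^bold>j + \<^bold>k\<close>. The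
  cross product of two of them is therefore normal to this plane, hence orthogonal to a third, and
  any three vectors of a plane are linearly dependent.\<close>

lemma fib_quaternion_in_plane:
  "fib_quaternion n = real (fib n) *\<^sub>R (q_i + q_k) + real (fib (n + 1)) *\<^sub>R (q_j + q_k)"
  by (simp add: fib_quaternion_def algebra_simps)

text \<open>The triple product is the determinant of the coordinates, and here its third column is
  the sum of the other two.\<close>

lemma triple_product_fib_quaternion:
  "q_inner (q_cross (fib_quaternion k) (fib_quaternion m)) (fib_quaternion n) = 0"
  unfolding q_cross_coords[OF fib_quaternion_imag fib_quaternion_imag]
  unfolding fib_quaternion_in_plane
  by (simp add: q_inner_def quaternion_defs q_i_def q_j_def q_k_def algebra_simps)

text \<open>By Cramer's rule, the cyclically ordered \<open>2 \<times> 2\<close> minors of the coordinates with respect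
  to \<open>u\<close> and \<open>v\<close> are the coefficients of a relation. If all of them vanish, the coordinate pairs
  are pairwise proportional, so that the first vector is zero or the second is a multiple of it.\<close>

lemma linearly_dependent3_in_plane:
  fixes u v :: "'a::real_vector"
  shows "linearly_dependent3
    (p\<^sub>1 *\<^sub>R u + q\<^sub>1 *\<^sub>R v) (p\<^sub>2 *\<^sub>R u + q\<^sub>2 *\<^sub>R v) (p\<^sub>3 *\<^sub>R u + q\<^sub>3 *\<^sub>R v)"
    (is "linearly_dependent3 ?x ?y ?z")
proof -
  have comb: "a *\<^sub>R ?x + b *\<^sub>R ?y + c *\<^sub>R ?z
      = (a * p\<^sub>1 + b * p\<^sub>2 + c * p\<^sub>3) *\<^sub>R u + (a * q\<^sub>1 + b * q\<^sub>2 + c * q\<^sub>3) *\<^sub>R v" for a b c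
    by (simp add: algebra_simps)
  have relation: "linearly_dependent3 ?x ?y ?z"
    if "\<not> (a = 0 \<and> b = 0 \<and> c = 0)"
      and "a * p\<^sub>1 + b * p\<^sub>2 + c * p\<^sub>3 = 0" and "a * q\<^sub>1 + b * q\<^sub>2 + c * q\<^sub>3 = 0" for a b c
    unfolding linearly_dependent3_def comb using that
    by (intro exI[of _ a] exI[of _ b] exI[of _ c]) simp
  let ?a = "p\<^sub>2 * q\<^sub>3 - p\<^sub>3 * q\<^sub>2" and ?b = "p\<^sub>3 * q\<^sub>1 - p\<^sub>1 * q\<^sub>3" and ?c = "p\<^sub>1 * q\<^sub>2 - p\<^sub>2 * q\<^sub>1"
  consider "\<not> (?a = 0 \<and> ?b = 0 \<and> ?c = 0)" | "p\<^sub>1 = 0" "q\<^sub>1 = 0" | "?c = 0" "p\<^sub>1 \<noteq> 0" | "?c = 0" "q\<^sub>1 \<noteq> 0"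
    by blast
  then show ?thesis
  proof cases
    case 1
    then show ?thesis by (rule relation) (simp_all add: algebra_simps)
  next
    case 2
    then show ?thesis by (intro relation[of 1 0 0]) simp_all
  next
    case 3
    then show ?thesis by (intro relation[of p\<^sub>2 "- p\<^sub>1" 0]) (simp_all add: algebra_simps)
  next
    case 4
    then show ?thesis by (intro relation[of q\<^sub>2 "- q\<^sub>1" 0]) (simp_all add: algebra_simps)
  qed
qed

theorem proposition3p1:
  fixes k m n :: nat
  shows "q_inner (q_cross (fib_quaternion k) (fib_quaternion m)) (fib_quaternion n) = 0
    \<and> linearly_dependent3 (fib_quaternion k) (fib_quaternion m) (fib_quaternion n)"
proof
  show "q_inner (q_cross (fib_quaternion k) (fib_quaternion m)) (fib_quaternion n) = 0"
    by (rule triple_product_fib_quaternion)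
  show "linearly_dependent3 (fib_quaternion k) (fib_quaternion m) (fib_quaternion n)"
    unfolding fib_quaternion_in_plane by (rule linearly_dependent3_in_plane)
qed

end
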